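(* Let $\omega\in(0,1/2)$ and $\delta\in(0,\pi]$, and let $\lambda_\delta(n)=\frac{6}{\delta^2}\left(1-\frac{\sin(n\delta)}{n\delta}\right)$ for $n\in\mathbb{Z}^+$. For $\gamma>0$ consider the minimization problem $$\min_{N\in\mathbb{Z}^+}\ E^{\mathrm{tot}}(N,\gamma),\qquad E^{\mathrm{tot}}(N,\gamma)=2N+\frac{2\gamma}{\pi}F(N;\delta,\omega),\qquad F(N;\delta,\omega)=\sum_{m=1}^{\infty}\frac{1}{\lambda_\delta(mN)}\left(\frac{\sin(m\pi\omega)}{m}\right)^2 .$$ Let $N^*(\gamma)$ be the optimal number of bubbles, i.e. the largest minimizer of $E^{\mathrm{tot}}(\cdot,\gamma)$ over $\mathbb{Z}^+$, and let $\tilde N$ be the smallest $N\in\mathbb{Z}^+$ at which $F(\cdot;\delta,\omega)$ attains its global minimum over $\mathbb{Z}^+$. Then $N^*(\gamma)$ is a nondecreasing function of $\gamma$, with the upper bound $$N^*(\gamma)\le \tilde N\qquad\text{for all }\gamma>0 .$$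
   Context: The numbers $\lambda_\delta(n)$ are the eigenvalues (on $e^{inx}$, with $2\pi$-periodic boundary conditions) of the one-dimensional nonlocal operator with constant kernel $\rho_\delta(s)=3/\delta^3$ on $[-\delta,\delta]$. *)

theory Defs
  imports Complex_Main
begin

text \<open>The operator is \<open>u \<mapsto> \<integral> (u x - u (x + s)) \<rho>\<^sub>\<delta>(s) ds\<close> over
  \<open>[-\<delta>, \<delta>]\<close> with \<open>\<rho>\<^sub>\<delta> = 3 / \<delta>\<^sup>3\<close>; on \<open>e\<^sup>i\<^sup>n\<^sup>x\<close> its eigenvalue is
  \<open>(3 / \<delta>\<^sup>3) \<integral> (1 - cos (n s)) ds\<close>, which evaluates to the closed form below.  Only
  \<open>n > 0\<close> is meaningful.\<close>

definition nonlocal_eigenvalue :: "real \<Rightarrow> nat \<Rightarrow> real" where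
  "nonlocal_eigenvalue \<delta> n = 6 / \<delta>\<^sup>2 * (1 - sin (real n * \<delta>) / (real n * \<delta>))"

text \<open>The summation index is shifted: the \<open>m\<close>-th term of the series over positive
  integers is taken at \<open>Suc m\<close>.\<close>

definition F :: "real \<Rightarrow> real \<Rightarrow> nat \<Rightarrow> real" where
  "F \<delta> \<omega> N =
     (\<Sum>m. 1 / nonlocal_eigenvalue \<delta> (Suc m * N)
          * (sin (real (Suc m) * pi * \<omega>) / real (Suc m))\<^sup>2)"

definition E_tot :: "real \<Rightarrow> real \<Rightarrow> nat \<Rightarrow> real \<Rightarrow> real" where
  "E_tot \<delta> \<omega> N \<gamma> = 2 * real N + 2 * \<gamma> / pi * F \<delta> \<omega> N"

definition E_minimizer :: "real \<Rightarrow> real \<Rightarrow> real \<Rightarrow> nat \<Rightarrow> bool" where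
  "E_minimizer \<delta> \<omega> \<gamma> = is_arg_min (\<lambda>N. E_tot \<delta> \<omega> N \<gamma>) (\<lambda>N. 0 < N)"

definition F_minimizer :: "real \<Rightarrow> real \<Rightarrow> nat \<Rightarrow> bool" where
  "F_minimizer \<delta> \<omega> = is_arg_min (F \<delta> \<omega>) (\<lambda>N. 0 < N)"

text \<open>\<open>GREATEST\<close> and \<open>LEAST\<close> are unspecified when no greatest or least element
  exists; the theorem therefore also asserts that both are well defined.\<close>

definition N_star :: "real \<Rightarrow> real \<Rightarrow> real \<Rightarrow> nat" where
  "N_star \<delta> \<omega> \<gamma> = (GREATEST N. E_minimizer \<delta> \<omega> \<gamma> N)"

definition N_tilde :: "real \<Rightarrow> real \<Rightarrow> nat" where
  "N_tilde \<delta> \<omega> = (LEAST N. F_minimizer \<delta> \<omega> N)"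

end

theory Submission
  imports Defs "HOL-Analysis.Analysis"
begin

text \<open>
  Once \<open>F\<close> is known to attain its minimum, the theorem is an exchange argument.  Going beyond
  a minimizer of \<open>F\<close> only increases \<open>E_tot\<close>, so the minimizers of \<open>E_tot\<close> lie in a finite
  range bounded by \<open>N_tilde\<close>.  Adding the two optimality inequalities for parameters
  \<open>\<gamma>1 < \<gamma>2\<close> shows that the minimizer for \<open>\<gamma>2\<close> has the smaller or equal value of \<open>F\<close>, and
  optimality at \<open>\<gamma>1\<close> then makes it the larger or equal number (\<open>E_minimizer_mono\<close>).

  The analytic content is that \<open>F\<close>, which converges to
  \<open>F\<^sub>\<infinity> = \<delta>\<^sup>2 / 6 * (\<Sum>m. weight \<omega> m)\<close>, does not approach this limit strictly from above:
  some \<open>N > 0\<close> satisfies \<open>F N \<le> F\<^sub>\<infinity>\<close> (\<open>exists_F_le_limit\<close>).  For \<open>\<delta> = pi\<close> the function \<open>F\<close> is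
  constant on positive integers.  For \<open>\<delta> < pi\<close>, expand \<open>1 / (1 - s)\<close> with
  \<open>s = sin (m N \<delta>) / (m N \<delta>)\<close> to first order (\<open>F_expansion\<close>): up to \<open>O(1 / N\<^sup>2)\<close>,
  \<open>F N - F\<^sub>\<infinity>\<close> is a positive multiple of \<open>oscillation \<omega> (N \<delta>) / (N \<delta>)\<close>, where
  \<open>oscillation \<omega> x = (\<Sum>m. sin\<^sup>2 (m \<pi> \<omega>) * sin (m x) / m\<^sup>3)\<close> is an odd, \<open>2\<pi>\<close>-periodic Lipschitz
  function.  By Dirichlet's approximation theorem, \<open>(N + 1) \<delta>\<close> is arbitrarily close to a multiple of
  \<open>2\<pi>\<close> for arbitrarily large \<open>N\<close>; there the oscillation is close to its value at \<open>- \<delta>\<close>, which is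
  \<open>- oscillation \<omega> \<delta>\<close>.  Such \<open>N\<close>, if large, therefore give \<open>F N < F\<^sub>\<infinity>\<close> as soon as \<open>oscillation \<omega> \<delta> > 0\<close>.

  Positivity of the oscillation on \<open>(0, \<pi>)\<close> (\<open>oscillation_pos\<close>) starts from the Poisson kernel of
  the disc.  Its part odd in both angles, \<open>\<Sum>m. r^m * sin (m x) * sin (m t)\<close>, is positive for
  \<open>x, t \<in> (0, \<pi>)\<close> because the kernel decreases away from the diagonal.
  Integrating in \<open>t\<close> from \<open>0\<close> to \<open>2\<pi>\<omega> < \<pi>\<close>
  turns \<open>sin (m t)\<close> into \<open>2 sin\<^sup>2 (m \<pi> \<omega>) / m\<close>, and integrating twice against \<open>dr / r\<close>
  supplies the remaining factor \<open>1 / m\<^sup>2\<close>.  The last integration reaches \<open>r = 1\<close> with strict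
  positivity, since each integral is strictly increasing in \<open>r\<close>.
\<close>

section \<open>Positivity from the Poisson kernel\<close>

text \<open>This is the real part of the geometric series of \<open>r e\<^sup>i\<^sup>y\<close>, written so that the right-hand side
  depends on \<open>cos y\<close> through one denominator only; its monotonicity in \<open>cos y\<close> is then visible.\<close>

lemma geometric_cos_sums:
  fixes r y :: real
  assumes "0 < r" "r < 1"
  shows "(\<lambda>m. r ^ m * cos (real m * y)) sums
           (1 / 2 + (1 - r\<^sup>2) / (2 * (1 - 2 * r * cos y + r\<^sup>2)))"
proof -
  define c where "c = cos y"
  have D: "1 - 2 * r * c + r\<^sup>2 > 0"
  proof -
    have "r * c \<le> r" using assms by (simp add: c_def)
    moreover have "(1 - r)\<^sup>2 > 0" using assms by simp
    ultimately show ?thesis by (simp add: power2_diff)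
  qed
  have "(\<lambda>m. rcis r y ^ m) sums (1 / (1 - rcis r y))"
    using assms by (intro geometric_sums) simp
  from sums_Re[OF this] have S: "(\<lambda>m. r ^ m * cos (real m * y)) sums Re (1 / (1 - rcis r y))"
    by (simp add: DeMoivre2 del: Re_divide)
  have N: "(1 - r * cos y)\<^sup>2 + (r * sin y)\<^sup>2 = 1 - 2 * r * cos y + r\<^sup>2"
    using sin_cos_squared_add[of y] by algebra
  have "Re (1 / (1 - rcis r y)) = (1 - r * c) / (1 - 2 * r * c + r\<^sup>2)"
    using N by (simp add: Re_divide c_def)
  also have "\<dots> = 1 / 2 + (1 - r\<^sup>2) / (2 * (1 - 2 * r * c + r\<^sup>2))"
    using D by (simp add: field_simps)
  finally show ?thesis using S by (simp add: c_def)
qed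

text \<open>The product of sines is half the difference of \<open>cos (m (x - t))\<close> and \<open>cos (m (x + t))\<close>, so the
  sum is half the difference of two Poisson kernels, and the kernel is increasing in the cosine of its angle.
  The condition \<open>x, t \<in> (0, \<pi>)\<close> enters through \<open>cos (x - t) - cos (x + t) = 2 sin x sin t > 0\<close>.\<close>

lemma dirichlet_poisson_kernel_pos:
  fixes r x t :: real
  assumes r: "0 < r" "r < 1" and x: "0 < x" "x < pi" and t: "0 < t" "t < pi"
  shows "(\<Sum>m. r ^ m * (sin (real m * x) * sin (real m * t))) > 0"
proof -
  define P where "P y = 1 / 2 + (1 - r\<^sup>2) / (2 * (1 - 2 * r * cos y + r\<^sup>2))" for y
  have "(\<lambda>m. (r ^ m * cos (real m * (x - t)) - r ^ m * cos (real m * (x + t))) / 2) sums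
          ((P (x - t) - P (x + t)) / 2)"
    unfolding P_def by (intro sums_divide sums_diff geometric_cos_sums r)
  also have "(\<lambda>m. (r ^ m * cos (real m * (x - t)) - r ^ m * cos (real m * (x + t))) / 2) =
             (\<lambda>m. r ^ m * (sin (real m * x) * sin (real m * t)))"
    by (simp add: sin_times_sin right_diff_distrib distrib_left diff_divide_distrib)
  finally have S: "(\<Sum>m. r ^ m * (sin (real m * x) * sin (real m * t))) = (P (x - t) - P (x + t)) / 2"
    by (simp add: sums_iff)
  have "sin x * sin t > 0" using x t by (simp add: sin_gt_zero)
  hence "cos (x + t) < cos (x - t)" by (simp add: cos_add cos_diff)
  hence less: "1 - 2 * r * cos (x - t) + r\<^sup>2 < 1 - 2 * r * cos (x + t) + r\<^sup>2"
    using r by simp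
  have "r * cos (x - t) \<le> r" using r by simp
  moreover have "(1 - r)\<^sup>2 > 0" using r by simp
  ultimately have pos: "1 - 2 * r * cos (x - t) + r\<^sup>2 > 0" by (simp add: power2_diff)
  have "r\<^sup>2 < 1" using r by (simp add: power_less_one_iff)
  hence "P (x + t) < P (x - t)"
    unfolding P_def using less pos by (intro add_strict_left_mono divide_strict_left_mono) auto
  thus ?thesis by (simp add: S)
qed

text \<open>The \<open>h\<close>-derivative of the sum is the positive kernel of the previous lemma, and the sum vanishes at
  \<open>h = 0\<close>.  The factor \<open>r ^ m\<close> makes the differentiated series converge uniformly.\<close>

lemma integrated_poisson_kernel_pos:
  fixes r x h :: real
  assumes r: "0 < r" "r < 1" and x: "0 < x" "x < pi" and h: "0 < h" "h < pi"
  shows "(\<Sum>m. r ^ m * (sin (real m * x) * (1 - cos (real m * h)) / real m)) > 0"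
proof -
  define g where "g m t = r ^ m * (sin (real m * x) * (1 - cos (real m * t)) / real m)" for m t
  define k where "k m t = r ^ m * (sin (real m * x) * sin (real m * t))" for m t
  have deriv: "((\<lambda>t. \<Sum>m. g m t) has_field_derivative (\<Sum>m. k m t)) (at t)" for t
  proof (rule has_field_derivative_series'(2)[where S = UNIV and ?x0.0 = 0])
    show "(g m has_field_derivative k m t) (at t within UNIV)" for m t
      unfolding g_def k_def
      by (cases "m = 0") (auto intro!: derivative_eq_intros)
    show "uniformly_convergent_on UNIV (\<lambda>n t. \<Sum>m<n. k m t)"
    proof (rule Weierstrass_m_test')
      show "norm (k m t) \<le> r ^ m" for m t
      proof -
        have "\<bar>sin (real m * x)\<bar> * \<bar>sin (real m * t)\<bar> \<le> 1 * 1"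
          by (intro mult_mono) auto
        thus ?thesis
          using r mult_left_mono[of _ 1 "r ^ m"] by (simp add: k_def abs_mult)
      qed
      show "summable (\<lambda>m. r ^ m)" using r by simp
    qed
  qed (auto simp: g_def)
  have "(\<Sum>m. g m 0) < (\<Sum>m. g m h)"
  proof (rule DERIV_pos_imp_increasing_open[OF h(1)])
    show "continuous_on {0..h} (\<lambda>t. \<Sum>m. g m t)"
      using deriv by (meson DERIV_isCont continuous_at_imp_continuous_on)
    show "\<exists>y. ((\<lambda>t. \<Sum>m. g m t) has_field_derivative y) (at t) \<and> 0 < y"
      if "0 < t" "t < h" for t
      using deriv[of t] dirichlet_poisson_kernel_pos[OF r x, of t] that h
      by (auto simp: k_def)
  qed
  thus ?thesis by (simp add: g_def)
qed

text \<open>Division of the \<open>m\<close>-th coefficient by \<open>m\<close> is integration against \<open>dr / r\<close>: the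
  hypothesis is about \<open>r f'(r)\<close> and the conclusion about \<open>f(r)\<close>.  Absolute summability makes \<open>f\<close> continuous
  up to \<open>r = 1\<close>, which is how positivity inside the disc becomes strict positivity on its boundary.\<close>

lemma powser_pos_of_weighted_pos:
  fixes b :: "nat \<Rightarrow> real"
  assumes b0: "b 0 = 0" and sb: "summable (\<lambda>m. \<bar>b m\<bar>)"
    and pos: "\<And>r. 0 < r \<Longrightarrow> r < 1 \<Longrightarrow> (\<Sum>m. r ^ m * (real m * b m)) > 0"
    and r: "0 < r" "r \<le> 1"
  shows "(\<Sum>m. r ^ m * b m) > 0"
proof -
  define f where "f s = (\<Sum>m. b m * s ^ m)" for s
  have sm: "summable b" using sb by (rule summable_rabs_cancel)
  have "f 0 < f r"
  proof (rule DERIV_pos_imp_increasing_open[where f = f and a = 0 and b = r])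
    have cont: "continuous_on {0..r} (\<lambda>s. \<Sum>m<n. b m * s ^ m)" for n
      by (intro continuous_intros)
    have "uniform_limit {0..r} (\<lambda>n s. \<Sum>m<n. b m * s ^ m) f sequentially"
      unfolding f_def
    proof (rule Weierstrass_m_test[OF _ sb])
      show "norm (b m * s ^ m) \<le> \<bar>b m\<bar>" if "s \<in> {0..r}" for m s
        using that r by (simp add: abs_mult power_le_one mult_left_le)
    qed
    thus "continuous_on {0..r} f"
      by (intro uniform_limit_theorem[where F = sequentially and l = f]) (auto simp: cont)
    show "\<exists>y. (f has_field_derivative y) (at s) \<and> 0 < y" if s: "0 < s" "s < r" for s
    proof -
      have D: "(f has_field_derivative (\<Sum>m. diffs b m * s ^ m)) (at s)"
        unfolding f_def by (rule termdiffs_strong[where K = 1]) (use s r sm in auto)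
      have "summable (\<lambda>m. diffs b m * s ^ m)"
      proof (rule termdiff_converges)
        show "norm s < 1" using s r by simp
        show "summable (\<lambda>m. b m * z ^ m)" if "norm z < 1" for z
          by (rule powser_inside[where x = 1]) (use sm that in auto)
      qed
      from sums_mult[OF diffs_equiv[OF this], of s]
      have "(\<lambda>m. s * (real m * b m * s ^ (m - Suc 0))) sums (s * (\<Sum>m. diffs b m * s ^ m))" .
      moreover have "s * (real m * b m * s ^ (m - Suc 0)) = s ^ m * (real m * b m)" for m
        by (cases m) auto
      ultimately have "s * (\<Sum>m. diffs b m * s ^ m) = (\<Sum>m. s ^ m * (real m * b m))"
        by (simp add: sums_iff)
      hence "s * (\<Sum>m. diffs b m * s ^ m) > 0" using pos[of s] s r by simp
      hence "(\<Sum>m. diffs b m * s ^ m) > 0" using s by (simp add: zero_less_mult_iff)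
      with D show ?thesis by blast
    qed
  qed fact
  moreover have "f 0 = 0" using b0 by (simp add: f_def)
  ultimately show ?thesis by (simp add: f_def mult.commute)
qed

section \<open>The oscillation function\<close>

definition weight :: "real \<Rightarrow> nat \<Rightarrow> real" where
  "weight \<omega> m = (sin (real m * pi * \<omega>) / real m)\<^sup>2"

text \<open>Up to the factor \<open>\<delta>\<^sup>2 / 6\<close>, the coefficient of \<open>1 / (N \<delta>)\<close> in the large-\<open>N\<close> expansion of \<open>F\<close>, as a function of the phase
  \<open>x = N \<delta>\<close>.  Summation starts at \<open>m = 0\<close>, where \<open>x / 0 = 0\<close> makes the term vanish; this
  matches power series indexing.\<close>

definition oscillation :: "real \<Rightarrow> real \<Rightarrow> real" where
  "oscillation \<omega> x = (\<Sum>m. weight \<omega> m * (sin (real m * x) / real m))"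

lemma weight_nonneg [simp]: "weight \<omega> m \<ge> 0"
  by (simp add: weight_def)

lemma weight_0 [simp]: "weight \<omega> 0 = 0"
  by (simp add: weight_def)

lemma summable_inverse_squares: "summable (\<lambda>m. 1 / (real m)\<^sup>2)"
  using inverse_power_summable[of 2, where 'a = real] by (simp add: field_simps)

lemma summable_weight [simp]: "summable (weight \<omega>)"
proof (rule summable_comparison_test'[OF summable_inverse_squares])
  show "norm (weight \<omega> m) \<le> 1 / (real m)\<^sup>2" for m
    by (simp add: weight_def power_divide divide_right_mono abs_square_le_1)
qed

lemma abs_oscillation_term_le: "\<bar>weight \<omega> m * (sin (real m * x) / real m)\<bar> \<le> weight \<omega> m"
proof (cases "m = 0")
  case False
  hence "\<bar>sin (real m * x)\<bar> \<le> real m"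
    using abs_sin_le_one[of "real m * x"] by linarith
  hence "\<bar>sin (real m * x) / real m\<bar> \<le> 1" using False by (simp add: field_simps)
  from mult_left_mono[OF this, of "weight \<omega> m"] show ?thesis by (simp add: abs_mult)
qed simp

lemma summable_oscillation: "summable (\<lambda>m. weight \<omega> m * (sin (real m * x) / real m))"
  by (rule summable_comparison_test'[OF summable_weight]) (use abs_oscillation_term_le in auto)

lemma abs_oscillation_le: "\<bar>oscillation \<omega> x\<bar> \<le> (\<Sum>m. weight \<omega> m)"
  unfolding oscillation_def
  using norm_suminf_le[OF _ summable_weight,
      of "\<lambda>m. weight \<omega> m * (sin (real m * x) / real m)"] abs_oscillation_term_le by auto

text \<open>By \<open>2 sin\<^sup>2 (m \<pi> \<omega>) = 1 - cos (m h)\<close> with \<open>h = 2\<pi>\<omega>\<close>, the oscillation is, up to the factor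
  \<open>2\<close>, the integrated Poisson kernel with two further factors \<open>1 / m\<close>, taken at \<open>r = 1\<close>.  The condition
  \<open>\<omega> < 1/2\<close> is what puts \<open>h\<close> into \<open>(0, \<pi>)\<close>.\<close>

lemma oscillation_pos:
  assumes \<omega>: "0 < \<omega>" "\<omega> < 1/2" and x: "0 < x" "x < pi"
  shows "oscillation \<omega> x > 0"
proof -
  define h where "h = 2 * pi * \<omega>"
  have h: "0 < h" "h < pi" using \<omega> by (auto simp: h_def)
  define c where "c m = sin (real m * x) * (1 - cos (real m * h))" for m
  have weight_eq: "weight \<omega> m = (1 - cos (real m * h)) / (2 * (real m)\<^sup>2)" for m
    using cos_double_sin[of "real m * pi * \<omega>"]
    by (simp add: weight_def h_def power_divide mult_ac)
  have c2: "c m / (real m)^2 = 2 * sin (real m * x) * weight \<omega> m" for m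
    by (simp add: c_def weight_eq)
  have c3: "c m / (real m)^3 = 2 * (weight \<omega> m * (sin (real m * x) / real m))" for m
    by (simp add: c_def weight_eq power3_eq_cube power2_eq_square mult_ac)
  have twice: "(\<Sum>m. r ^ m * (c m / (real m)\<^sup>2)) > 0" if "0 < r" "r < 1" for r
  proof (rule powser_pos_of_weighted_pos)
    show "summable (\<lambda>m. \<bar>c m / (real m)\<^sup>2\<bar>)"
    proof (rule summable_comparison_test'[OF summable_mult[OF summable_weight, of 2]])
      show "norm \<bar>c m / (real m)\<^sup>2\<bar> \<le> 2 * weight \<omega> m" for m
        by (simp add: c2 abs_mult mult_left_le_one_le)
    qed
    have "real m * (c m / (real m)\<^sup>2) = c m / real m" for m
      by (simp add: power2_eq_square)
    thus "(\<Sum>m. r ^ m * (real m * (c m / (real m)\<^sup>2))) > 0" if "0 < r" "r < 1" for r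
      using integrated_poisson_kernel_pos[OF that x h] by (simp add: c_def)
  qed (use that in auto)
  have "(\<Sum>m. 1 ^ m * (c m / (real m)^3)) > 0"
  proof (rule powser_pos_of_weighted_pos)
    show "summable (\<lambda>m. \<bar>c m / (real m)^3\<bar>)"
    proof (rule summable_comparison_test'[OF summable_mult[OF summable_weight, of 2]])
      show "norm \<bar>c m / (real m)^3\<bar> \<le> 2 * weight \<omega> m" for m
        unfolding c3 using abs_oscillation_term_le[of \<omega> m x] by (simp add: abs_mult)
    qed
    have "real m * (c m / (real m)^3) = c m / (real m)\<^sup>2" for m
      by (simp add: power2_eq_square power3_eq_cube)
    thus "(\<Sum>m. r ^ m * (real m * (c m / (real m)^3))) > 0" if "0 < r" "r < 1" for r
      using twice[OF that] by simp
  qed auto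
  moreover have "(\<Sum>m. 1 ^ m * (c m / (real m)^3)) = 2 * oscillation \<omega> x"
    unfolding c3 oscillation_def using suminf_mult[OF summable_oscillation, of 2 \<omega> x] by simp
  ultimately show ?thesis by simp
qed

lemma oscillation_minus: "oscillation \<omega> (- x) = - oscillation \<omega> x"
  unfolding oscillation_def using suminf_minus[OF summable_oscillation, of \<omega> x] by simp

lemma oscillation_periodic: "oscillation \<omega> (x + 2 * pi * of_int j) = oscillation \<omega> x"
proof -
  have "sin (real m * (x + 2 * pi * of_int j)) = sin (real m * x)" for m
  proof -
    have "sin (real m * (x + 2 * pi * of_int j)) = sin (real m * x + 2 * pi * of_int (int m * j))"
      by (simp add: algebra_simps)
    also have "\<dots> = sin (real m * x)"
      using sin_cos_eq_iff[THEN iffD2, of "real m * x + 2 * pi * of_int (int m * j)" "real m * x"]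
      by metis
    finally show ?thesis .
  qed
  thus ?thesis by (simp add: oscillation_def)
qed

text \<open>The factor \<open>1 / m\<close> in each term absorbs the Lipschitz constant \<open>m\<close> of \<open>sin (m x)\<close>.\<close>

lemma oscillation_lipschitz: "\<bar>oscillation \<omega> x - oscillation \<omega> y\<bar> \<le> (\<Sum>m. weight \<omega> m) * \<bar>x - y\<bar>"
proof -
  have sin_lip: "\<bar>sin u - sin v\<bar> \<le> \<bar>u - v\<bar>" for u v :: real
  proof -
    have "\<bar>sin u - sin v\<bar> = 2 * \<bar>sin ((u - v) / 2)\<bar> * \<bar>cos ((u + v) / 2)\<bar>"
      by (simp add: sin_diff_sin abs_mult)
    also have "\<dots> \<le> 2 * \<bar>(u - v) / 2\<bar> * 1"
      by (intro mult_mono abs_sin_x_le_abs_x) auto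
    finally show ?thesis by simp
  qed
  have "oscillation \<omega> x - oscillation \<omega> y =
      (\<Sum>m. weight \<omega> m * (sin (real m * x) / real m) - weight \<omega> m * (sin (real m * y) / real m))"
    unfolding oscillation_def by (rule suminf_diff) (rule summable_oscillation)+
  also have "norm \<dots> \<le> (\<Sum>m. weight \<omega> m * \<bar>x - y\<bar>)"
  proof (rule norm_suminf_le)
    show "summable (\<lambda>m. weight \<omega> m * \<bar>x - y\<bar>)" by (intro summable_mult2) simp
    show "norm (weight \<omega> m * (sin (real m * x) / real m) - weight \<omega> m * (sin (real m * y) / real m))
        \<le> weight \<omega> m * \<bar>x - y\<bar>" for m
    proof (cases "m = 0")
      case False
      have "\<bar>sin (real m * x) - sin (real m * y)\<bar> / real m \<le> \<bar>real m * x - real m * y\<bar> / real m"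
        by (intro divide_right_mono sin_lip) auto
      also have "\<bar>real m * x - real m * y\<bar> / real m = \<bar>x - y\<bar>"
        using False by (simp add: abs_mult flip: right_diff_distrib)
      finally have "weight \<omega> m * (\<bar>sin (real m * x) - sin (real m * y)\<bar> / real m) \<le> weight \<omega> m * \<bar>x - y\<bar>"
        by (intro mult_left_mono) auto
      moreover have "\<bar>weight \<omega> m * (sin (real m * x) / real m) - weight \<omega> m * (sin (real m * y) / real m)\<bar>
         = weight \<omega> m * (\<bar>sin (real m * x) - sin (real m * y)\<bar> / real m)"
        by (simp add: abs_mult flip: right_diff_distrib diff_divide_distrib)
      ultimately show ?thesis by simp
    qed simp
  qed
  also have "\<dots> = (\<Sum>m. weight \<omega> m) * \<bar>x - y\<bar>" by (rule suminf_mult2[symmetric]) simp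
  finally show ?thesis by simp
qed


text \<open>Dirichlet's theorem gives some multiplier \<open>k > 0\<close> but no lower bound on it.  Applying it to
  \<open>(K + 1) \<delta> / (2\<pi>)\<close> in place of \<open>\<delta> / (2\<pi>)\<close> makes the return time \<open>q = k (K + 1)\<close> exceed \<open>K\<close>; one step
  before the return, at \<open>N = q - 1\<close>, the phase is near \<open>- \<delta>\<close>.  Rational and irrational \<open>\<delta> / \<pi>\<close> are
  treated alike.\<close>

lemma exists_return_near_minus:
  fixes \<delta> \<epsilon> :: real
  assumes "\<epsilon> > 0"
  obtains N :: nat and j :: int
    where "N \<ge> K" "\<bar>real N * \<delta> + \<delta> - 2 * pi * of_int j\<bar> < \<epsilon>"
proof -
  obtain n :: nat where n: "n > 0" "1 / real n < \<epsilon> / (2 * pi)"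
    using assms real_arch_inverse[of "\<epsilon> / (2 * pi)"] by (auto simp: inverse_eq_divide)
  obtain h k where k: "0 < k" "\<bar>of_int k * (real (Suc K) * \<delta> / (2 * pi)) - of_int h\<bar> < 1 / real n"
    using Dirichlet_approx[OF n(1)] by metis
  define q where "q = nat k * Suc K"
  have kq: "real q = of_int k * real (Suc K)" using k(1) by (simp add: q_def algebra_simps)
  have "1 * Suc K \<le> q" unfolding q_def using k(1) by (intro mult_right_mono) auto
  hence q: "q \<ge> Suc K" by simp
  have "\<bar>real q * \<delta> - 2 * pi * of_int h\<bar>
        = 2 * pi * \<bar>of_int k * (real (Suc K) * \<delta> / (2 * pi)) - of_int h\<bar>"
  proof -
    have "real q * \<delta> - 2 * pi * of_int h
        = 2 * pi * (of_int k * (real (Suc K) * \<delta> / (2 * pi)) - of_int h)"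
      unfolding kq by (simp add: right_diff_distrib)
    thus ?thesis by (simp add: abs_mult)
  qed
  also have "\<dots> < 2 * pi * (\<epsilon> / (2 * pi))"
    using k n by (intro mult_strict_left_mono) auto
  finally have "\<bar>real q * \<delta> - 2 * pi * of_int h\<bar> < \<epsilon>" by simp
  moreover have "real (q - 1) * \<delta> + \<delta> = real q * \<delta>"
    using q by (simp add: of_nat_diff algebra_simps)
  ultimately show thesis using q by (intro that[of "q - 1" h]) auto
qed

lemma oscillation_frequently_negative:
  assumes "0 < \<omega>" "\<omega> < 1/2" "0 < \<delta>" "\<delta> < pi"
  obtains N where "N \<ge> K" "oscillation \<omega> (real N * \<delta>) \<le> - (oscillation \<omega> \<delta> / 2)"
proof -
  define A where "A = (\<Sum>m. weight \<omega> m)"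
  have pos: "oscillation \<omega> \<delta> > 0" by (rule oscillation_pos) (use assms in auto)
  have A: "A > 0" using pos abs_oscillation_le[of \<omega> \<delta>] by (simp add: A_def)
  \<comment> \<open>\<open>A\<close> is a Lipschitz constant, so a phase error below \<open>\<epsilon>\<close> costs at most half of the value at \<open>\<delta>\<close>.\<close>
  define \<epsilon> where "\<epsilon> = oscillation \<omega> \<delta> / (2 * A)"
  have "\<epsilon> > 0" using A pos by (simp add: \<epsilon>_def)
  then obtain N j where N: "N \<ge> K" "\<bar>real N * \<delta> + \<delta> - 2 * pi * of_int j\<bar> < \<epsilon>"
    by (rule exists_return_near_minus)
  have "oscillation \<omega> (- \<delta> + 2 * pi * of_int j) = - oscillation \<omega> \<delta>"
    by (simp only: oscillation_periodic oscillation_minus)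
  moreover have "\<bar>oscillation \<omega> (real N * \<delta>) - oscillation \<omega> (- \<delta> + 2 * pi * of_int j)\<bar>
      \<le> A * \<bar>real N * \<delta> - (- \<delta> + 2 * pi * of_int j)\<bar>"
    unfolding A_def by (rule oscillation_lipschitz)
  moreover have "\<dots> \<le> A * \<epsilon>" using A N(2) by (intro mult_left_mono) auto
  moreover have "A * \<epsilon> = oscillation \<omega> \<delta> / 2" using A by (simp add: \<epsilon>_def)
  ultimately have "oscillation \<omega> (real N * \<delta>) \<le> - (oscillation \<omega> \<delta> / 2)" by linarith
  with N(1) show thesis by (rule that)
qed

section \<open>Asymptotics of \<open>F\<close>\<close>

lemma F_eq_weighted_sum:
  "F \<delta> \<omega> N = (\<Sum>m. \<delta>\<^sup>2 / 6 *
     (weight \<omega> (Suc m) / (1 - sin (real (Suc m * N) * \<delta>) / (real (Suc m * N) * \<delta>))))"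
  by (simp add: F_def weight_def nonlocal_eigenvalue_def mult_ac del: of_nat_Suc of_nat_mult)

text \<open>With \<open>s = sin (m X) / (m X)\<close>, the identity \<open>1 / (1 - s) = 1 + s + s\<^sup>2 / (1 - s)\<close> produces the limit
  value, the oscillation, and the remainder.  The bound \<open>X \<ge> 2\<close> gives \<open>\<bar>s\<bar> \<le> 1 / X \<le> 1 / 2\<close>, whence a
  remainder of at most \<open>2 / X\<^sup>2\<close> times the weight for each \<open>m\<close>.\<close>

lemma F_expansion:
  fixes \<delta> \<omega> :: real and N :: nat
  assumes \<delta>: "\<delta> > 0" and N: "real N * \<delta> \<ge> 2"
  defines "A \<equiv> (\<Sum>m. weight \<omega> m)" and "X \<equiv> real N * \<delta>"
  shows "\<bar>F \<delta> \<omega> N - \<delta>\<^sup>2 / 6 * (A + oscillation \<omega> X / X)\<bar> \<le> \<delta>\<^sup>2 / 6 * (2 * A / X\<^sup>2)"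
proof -
  have X: "X \<ge> 2" using N by (simp add: X_def)
  define s where "s m = sin (real m * X) / (real m * X)" for m
  define u where "u m = weight \<omega> m / (1 - s m)" for m
  define v where "v m = weight \<omega> m + weight \<omega> m * (sin (real m * X) / real m) / X" for m
  have v_sums: "v sums (A + oscillation \<omega> X / X)"
    unfolding v_def A_def oscillation_def
    by (intro sums_add sums_divide summable_sums summable_weight summable_oscillation)
  have bound: "\<bar>u m - v m\<bar> \<le> weight \<omega> m * (2 / X\<^sup>2)" for m
  proof (cases "m = 0")
    case False
    have "\<bar>s m\<bar> = \<bar>sin (real m * X)\<bar> / (real m * X)" using X by (simp add: s_def abs_mult)
    also have "\<dots> \<le> 1 / (1 * X)" using False X by (intro frac_le mult_right_mono) auto
    finally have s: "\<bar>s m\<bar> \<le> 1 / X" by simp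
    also have "\<dots> \<le> 1 / 2" using X by (intro frac_le) auto
    finally have s2: "1 - s m \<ge> 1 / 2" by linarith
    have "(s m)\<^sup>2 \<le> (1 / X)\<^sup>2" using power_mono[OF s, of 2] by simp
    hence "(s m)\<^sup>2 / (1 - s m) \<le> (1 / X)\<^sup>2 / (1 / 2)" using s2 by (intro frac_le) auto
    hence *: "(s m)\<^sup>2 / (1 - s m) \<le> 2 / X\<^sup>2" by (simp add: power_divide)
    have "u m - v m = weight \<omega> m * ((s m)\<^sup>2 / (1 - s m))"
    proof -
      have "v m = weight \<omega> m * (1 + s m)" by (simp add: v_def s_def algebra_simps)
      moreover have "1 / (1 - s m) - (1 + s m) = (s m)\<^sup>2 / (1 - s m)"
        using s2 by (simp add: field_simps power2_eq_square)
      ultimately show ?thesis unfolding u_def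
        by (metis mult.right_neutral right_diff_distrib times_divide_eq_right)
    qed
    moreover have "weight \<omega> m * ((s m)\<^sup>2 / (1 - s m)) \<le> weight \<omega> m * (2 / X\<^sup>2)"
      by (intro mult_left_mono *) simp
    moreover have "weight \<omega> m * ((s m)\<^sup>2 / (1 - s m)) \<ge> 0"
      using s2 by (intro mult_nonneg_nonneg divide_nonneg_nonneg) auto
    ultimately show ?thesis by linarith
  qed (simp add: u_def v_def)
  have sb: "summable (\<lambda>m. weight \<omega> m * (2 / X\<^sup>2))" by (intro summable_mult2) simp
  have "summable (\<lambda>m. u m - v m)"
    by (rule summable_comparison_test'[OF sb]) (use bound in auto)
  from summable_add[OF this sums_summable[OF v_sums]] have su: "summable u" by simp
  have "real (Suc m * N) * \<delta> = real (Suc m) * X" for m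
    by (simp only: of_nat_mult X_def mult.assoc)
  hence "F \<delta> \<omega> N = (\<Sum>m. \<delta>\<^sup>2 / 6 * u (Suc m))"
    unfolding F_eq_weighted_sum u_def s_def by (simp only:)
  also have "\<dots> = \<delta>\<^sup>2 / 6 * (\<Sum>m. u (Suc m))"
    using su by (intro suminf_mult) (simp add: summable_Suc_iff)
  also have "(\<Sum>m. u (Suc m)) = suminf u"
    using suminf_split_head[OF su] by (simp add: u_def)
  finally have F: "F \<delta> \<omega> N = \<delta>\<^sup>2 / 6 * suminf u" .
  have "\<bar>suminf u - (A + oscillation \<omega> X / X)\<bar> = norm (\<Sum>m. u m - v m)"
    using suminf_diff[OF su sums_summable[OF v_sums]] sums_unique[OF v_sums] by simp
  also have "\<dots> \<le> (\<Sum>m. weight \<omega> m * (2 / X\<^sup>2))"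
    by (rule norm_suminf_le[OF _ sb]) (use bound in auto)
  also have "\<dots> = 2 * A / X\<^sup>2"
    unfolding A_def using suminf_mult2[OF summable_weight[of \<omega>], of "2 / X\<^sup>2"] by (simp add: mult_ac)
  finally have "\<bar>suminf u - (A + oscillation \<omega> X / X)\<bar> \<le> 2 * A / X\<^sup>2" .
  hence "\<delta>\<^sup>2 / 6 * \<bar>suminf u - (A + oscillation \<omega> X / X)\<bar> \<le> \<delta>\<^sup>2 / 6 * (2 * A / X\<^sup>2)"
    by (intro mult_left_mono) auto
  moreover have "\<bar>\<delta>\<^sup>2 / 6 * (suminf u - (A + oscillation \<omega> X / X))\<bar>
      = \<delta>\<^sup>2 / 6 * \<bar>suminf u - (A + oscillation \<omega> X / X)\<bar>"
    by (simp add: abs_mult)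
  ultimately show ?thesis
    unfolding F by (simp only: right_diff_distrib)
qed

lemma F_tendsto:
  assumes \<delta>: "\<delta> > 0"
  shows "F \<delta> \<omega> \<longlonglongrightarrow> \<delta>\<^sup>2 / 6 * (\<Sum>m. weight \<omega> m)"
proof -
  define A where "A = (\<Sum>m. weight \<omega> m)"
  define X where "X N = real N * \<delta>" for N
  have X: "filterlim X at_top sequentially"
    unfolding X_def using \<delta>
    by (intro filterlim_at_top_mult_tendsto_pos[OF tendsto_const] filterlim_real_sequentially)
  have X2: "filterlim (\<lambda>N. (X N)\<^sup>2) at_top sequentially"
    by (intro filterlim_pow_at_top X) simp
  have "(\<lambda>N. \<delta>\<^sup>2 / 6 * (A / X N) + \<delta>\<^sup>2 / 6 * (2 * A / (X N)\<^sup>2)) \<longlonglongrightarrow> \<delta>\<^sup>2 / 6 * 0 + \<delta>\<^sup>2 / 6 * 0"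
    by (intro tendsto_intros real_tendsto_divide_at_top[OF tendsto_const] X X2)
  hence lim: "(\<lambda>N. \<delta>\<^sup>2 / 6 * (A / X N) + \<delta>\<^sup>2 / 6 * (2 * A / (X N)\<^sup>2)) \<longlonglongrightarrow> 0" by simp
  have "\<forall>\<^sub>F N in sequentially. X N \<ge> 2" using X by (simp add: filterlim_at_top)
  hence "\<forall>\<^sub>F N in sequentially. norm (F \<delta> \<omega> N - \<delta>\<^sup>2 / 6 * A)
           \<le> \<delta>\<^sup>2 / 6 * (A / X N) + \<delta>\<^sup>2 / 6 * (2 * A / (X N)\<^sup>2)"
  proof eventually_elim
    case (elim N)
    have "\<bar>oscillation \<omega> (X N) / X N\<bar> \<le> A / X N"
      using abs_oscillation_le[of \<omega> "X N"] elim by (simp add: A_def divide_right_mono)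
    hence "\<delta>\<^sup>2 / 6 * \<bar>oscillation \<omega> (X N) / X N\<bar> \<le> \<delta>\<^sup>2 / 6 * (A / X N)"
      by (intro mult_left_mono) auto
    moreover have "\<bar>\<delta>\<^sup>2 / 6 * (oscillation \<omega> (X N) / X N)\<bar> = \<delta>\<^sup>2 / 6 * \<bar>oscillation \<omega> (X N) / X N\<bar>"
      by (simp add: abs_mult)
    moreover have "\<bar>F \<delta> \<omega> N - \<delta>\<^sup>2 / 6 * (A + oscillation \<omega> (X N) / X N)\<bar> \<le> \<delta>\<^sup>2 / 6 * (2 * A / (X N)\<^sup>2)"
      using F_expansion[OF \<delta>, of N \<omega>] elim by (simp add: A_def X_def)
    ultimately show ?case by (simp only: distrib_left real_norm_def)
  qed
  from Lim_null_comparison[OF this lim] have "(\<lambda>N. F \<delta> \<omega> N - \<delta>\<^sup>2 / 6 * A) \<longlonglongrightarrow> 0" .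
  thus ?thesis by (simp add: LIM_zero_iff A_def)
qed

text \<open>At the integers \<open>N\<close> where the oscillation is at most some \<open>- c < 0\<close>, the first-order term is at most
  \<open>- c / X\<close>, which dominates the remainder \<open>2 A / X\<^sup>2\<close> once \<open>X > 2 A / c\<close>.  If \<open>\<delta> = \<pi>\<close>, the oscillation
  vanishes at every \<open>N \<delta>\<close>, but then all the sines in the eigenvalues vanish and \<open>F\<close> equals its limit.\<close>

lemma exists_F_le_limit:
  assumes "0 < \<omega>" "\<omega> < 1/2" "0 < \<delta>" "\<delta> \<le> pi"
  shows "\<exists>N>0. F \<delta> \<omega> N \<le> \<delta>\<^sup>2 / 6 * (\<Sum>m. weight \<omega> m)"
proof (cases "\<delta> = pi")
  case True
  have "F \<delta> \<omega> 1 = (\<Sum>m. \<delta>\<^sup>2 / 6 * weight \<omega> (Suc m))"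
    unfolding F_eq_weighted_sum using True sin_npi by (simp del: of_nat_Suc)
  also have "\<dots> = \<delta>\<^sup>2 / 6 * (\<Sum>m. weight \<omega> (Suc m))"
    by (intro suminf_mult) (simp add: summable_Suc_iff)
  also have "(\<Sum>m. weight \<omega> (Suc m)) = (\<Sum>m. weight \<omega> m)"
    using suminf_split_head[OF summable_weight, of \<omega>] by simp
  finally show ?thesis by (intro exI[of _ 1]) simp
next
  case False
  hence \<delta>: "0 < \<delta>" "\<delta> < pi" using assms by auto
  define A where "A = (\<Sum>m. weight \<omega> m)"
  define c where "c = oscillation \<omega> \<delta> / 2"
  have c: "c > 0" using oscillation_pos[OF assms(1,2) \<delta>] by (simp add: c_def)
  obtain K :: nat where K: "real K > max 2 (2 * A / c) / \<delta>"
    using reals_Archimedean2 by blast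
  obtain N where N: "N \<ge> K" "oscillation \<omega> (real N * \<delta>) \<le> - c"
    unfolding c_def using oscillation_frequently_negative[OF assms(1,2) \<delta>] by blast
  define X where "X = real N * \<delta>"
  have "real N > max 2 (2 * A / c) / \<delta>" using K N(1) by linarith
  hence "X > max 2 (2 * A / c)" using \<delta> by (simp add: X_def pos_divide_less_eq)
  hence X: "X \<ge> 2" "2 * A / c < X" by auto
  have "oscillation \<omega> X / X + 2 * A / X\<^sup>2 \<le> 0"
  proof -
    have "2 * A \<le> c * X" using X c by (simp add: field_simps)
    hence "2 * A / X \<le> c" using X by (simp add: field_simps)
    hence "(oscillation \<omega> X + 2 * A / X) / X \<le> 0"
      using N(2) X by (intro divide_nonpos_pos) (auto simp: X_def)
    thus ?thesis by (simp add: add_divide_distrib power2_eq_square)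
  qed
  hence "\<delta>\<^sup>2 / 6 * (oscillation \<omega> X / X + 2 * A / X\<^sup>2) \<le> 0"
    by (intro mult_nonneg_nonpos) auto
  moreover have "F \<delta> \<omega> N - \<delta>\<^sup>2 / 6 * (A + oscillation \<omega> X / X) \<le> \<delta>\<^sup>2 / 6 * (2 * A / X\<^sup>2)"
    using F_expansion[OF \<delta>(1), of N \<omega>] X by (auto simp: A_def X_def abs_le_iff)
  ultimately have "F \<delta> \<omega> N \<le> \<delta>\<^sup>2 / 6 * A" by (simp only: distrib_left)
  moreover have "N > 0" using X by (cases N) (auto simp: X_def)
  ultimately show ?thesis by (auto simp: A_def)
qed

section \<open>Existence and comparison of minimizers\<close>

text \<open>If some value lies strictly below the limit, all but finitely many values exceed it, and a minimum
  over a finite range is global.  Otherwise the limit is a lower bound, attained at \<open>n0\<close>.\<close>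

lemma attains_min_of_tendsto:
  fixes f :: "nat \<Rightarrow> real"
  assumes lim: "f \<longlonglongrightarrow> L" and ex: "n0 > 0" "f n0 \<le> L"
  shows "\<exists>n. is_arg_min f (\<lambda>n. 0 < n) n"
proof (cases "\<exists>n1>0. f n1 < L")
  case True
  then obtain n1 where n1: "n1 > 0" "f n1 < L" by blast
  obtain M where M: "\<And>n. n \<ge> M \<Longrightarrow> f n > f n1"
    using order_tendstoD(1)[OF lim n1(2)] by (auto simp: eventually_sequentially)
  have ne: "{1..max M n1} \<noteq> {}" using n1 by (auto simp: max_def)
  obtain n where n: "is_arg_min f (\<lambda>n. n \<in> {1..max M n1}) n"
    using ex_is_arg_min_if_finite[of "{1..max M n1}" f] ne by blast
  show ?thesis
  proof (intro exI[of _ n], unfold is_arg_min_linorder, intro conjI allI impI)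
    fix k :: nat assume k: "0 < k"
    have "f n \<le> f n1" using n n1 by (auto simp: is_arg_min_linorder)
    show "f n \<le> f k"
    proof (cases "k \<le> max M n1")
      case False
      hence "f n1 < f k" by (intro M) auto
      with \<open>f n \<le> f n1\<close> show ?thesis by simp
    qed (use n k in \<open>auto simp: is_arg_min_linorder\<close>)
  qed (use n in \<open>auto simp: is_arg_min_linorder\<close>)
next
  case False
  have "f n0 \<le> f n" if "n > 0" for n
  proof (rule order.trans[OF ex(2)])
    show "L \<le> f n" using False that by (meson not_less)
  qed
  hence "is_arg_min f (\<lambda>n. 0 < n) n0" using ex(1) by (simp add: is_arg_min_linorder)
  thus ?thesis by blast
qed

lemma F_minimizer_N_tilde:
  assumes "0 < \<omega>" "\<omega> < 1/2" "0 < \<delta>" "\<delta> \<le> pi"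
  shows "F_minimizer \<delta> \<omega> (N_tilde \<delta> \<omega>)"
proof -
  obtain n where "F_minimizer \<delta> \<omega> n"
    using attains_min_of_tendsto[OF F_tendsto[OF assms(3), of \<omega>]] exists_F_le_limit[OF assms]
    by (auto simp: F_minimizer_def)
  thus ?thesis unfolding N_tilde_def by (rule LeastI)
qed

lemma E_minimizer_le_F_minimizer:
  assumes "E_minimizer \<delta> \<omega> \<gamma> N" "F_minimizer \<delta> \<omega> M" "\<gamma> > 0"
  shows "N \<le> M"
proof -
  have "E_tot \<delta> \<omega> N \<gamma> \<le> E_tot \<delta> \<omega> M \<gamma>" "F \<delta> \<omega> M \<le> F \<delta> \<omega> N"
    using assms by (auto simp: E_minimizer_def F_minimizer_def is_arg_min_linorder)
  moreover from this(2) have "2 * \<gamma> / pi * F \<delta> \<omega> M \<le> 2 * \<gamma> / pi * F \<delta> \<omega> N"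
    using assms(3) by (intro mult_left_mono) auto
  ultimately show ?thesis by (simp add: E_tot_def)
qed

text \<open>A minimizer \<open>M\<close> of \<open>F\<close> reduces the search to \<open>{1..M}\<close>: beyond \<open>M\<close> both parts of \<open>E_tot\<close> are at
  least as large as at \<open>M\<close>.\<close>

lemma E_minimizer_exists:
  assumes M: "F_minimizer \<delta> \<omega> M" and \<gamma>: "\<gamma> > 0"
  shows "\<exists>N. E_minimizer \<delta> \<omega> \<gamma> N"
proof -
  have M0: "M > 0" using M by (simp add: F_minimizer_def is_arg_min_linorder)
  obtain n where n: "is_arg_min (\<lambda>N. E_tot \<delta> \<omega> N \<gamma>) (\<lambda>N. N \<in> {1..M}) n"
    using ex_is_arg_min_if_finite[of "{1..M}" "\<lambda>N. E_tot \<delta> \<omega> N \<gamma>"] M0 by auto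
  have "E_tot \<delta> \<omega> n \<gamma> \<le> E_tot \<delta> \<omega> k \<gamma>" if "k > 0" for k
  proof (cases "k \<le> M")
    case True
    thus ?thesis using n that by (auto simp: is_arg_min_linorder)
  next
    case False
    have "F \<delta> \<omega> M \<le> F \<delta> \<omega> k"
      using M that by (auto simp: F_minimizer_def is_arg_min_linorder)
    hence "2 * \<gamma> / pi * F \<delta> \<omega> M \<le> 2 * \<gamma> / pi * F \<delta> \<omega> k"
      using \<gamma> by (intro mult_left_mono) auto
    hence "E_tot \<delta> \<omega> M \<gamma> \<le> E_tot \<delta> \<omega> k \<gamma>" using False by (simp add: E_tot_def)
    moreover have "E_tot \<delta> \<omega> n \<gamma> \<le> E_tot \<delta> \<omega> M \<gamma>"
      using n M0 by (auto simp: is_arg_min_linorder)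
    ultimately show ?thesis by simp
  qed
  thus ?thesis using n by (intro exI[of _ n]) (auto simp: E_minimizer_def is_arg_min_linorder)
qed

text \<open>Monotone comparative statics: adding the two optimality inequalities gives
  \<open>(\<gamma>2 - \<gamma>1) * (F N2 - F N1) \<le> 0\<close>, so \<open>F N2 \<le> F N1\<close>, and optimality of \<open>N1\<close> at \<open>\<gamma>1\<close> then forbids
  \<open>N2 < N1\<close>.  For \<open>\<gamma>1 < \<gamma>2\<close> this compares arbitrary minimizers, not only the largest ones.\<close>

lemma E_minimizer_mono:
  assumes N1: "E_minimizer \<delta> \<omega> \<gamma>1 N1" and N2: "E_minimizer \<delta> \<omega> \<gamma>2 N2"
    and \<gamma>: "0 < \<gamma>1" "\<gamma>1 < \<gamma>2"
  shows "N1 \<le> N2"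
proof -
  have e1: "E_tot \<delta> \<omega> N1 \<gamma>1 \<le> E_tot \<delta> \<omega> N2 \<gamma>1"
   and e2: "E_tot \<delta> \<omega> N2 \<gamma>2 \<le> E_tot \<delta> \<omega> N1 \<gamma>2"
    using N1 N2 by (auto simp: E_minimizer_def is_arg_min_linorder)
  define d where "d = 2 * (F \<delta> \<omega> N2 - F \<delta> \<omega> N1) / pi"
  have E: "E_tot \<delta> \<omega> N2 \<gamma> - E_tot \<delta> \<omega> N1 \<gamma> = 2 * (real N2 - real N1) + \<gamma> * d" for \<gamma>
    by (simp add: E_tot_def d_def field_simps)
  have "(\<gamma>2 - \<gamma>1) * d \<le> 0" using E[of \<gamma>1] E[of \<gamma>2] e1 e2 by (simp add: algebra_simps)
  hence "d \<le> 0" using \<gamma> by (simp add: mult_le_0_iff)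
  hence "\<gamma>1 * d \<le> 0" using \<gamma> by (simp add: mult_nonneg_nonpos)
  thus ?thesis using E[of \<gamma>1] e1 by simp
qed

theorem theorem3p1:
  fixes \<delta> \<omega> :: real
  assumes "0 < \<omega>" and "\<omega> < 1/2"
    and "0 < \<delta>" and "\<delta> \<le> pi"
  shows "(\<forall>\<gamma>>0. E_minimizer \<delta> \<omega> \<gamma> (N_star \<delta> \<omega> \<gamma>) \<and>
                (\<forall>N. E_minimizer \<delta> \<omega> \<gamma> N \<longrightarrow> N \<le> N_star \<delta> \<omega> \<gamma>)) \<and>
         F_minimizer \<delta> \<omega> (N_tilde \<delta> \<omega>) \<and>
         mono_on {0<..} (N_star \<delta> \<omega>) \<and>
         (\<forall>\<gamma>>0. N_star \<delta> \<omega> \<gamma> \<le> N_tilde \<delta> \<omega>)"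
proof -
  note tilde = F_minimizer_N_tilde[OF assms]
  have le_tilde: "N \<le> N_tilde \<delta> \<omega>" if "\<gamma> > 0" "E_minimizer \<delta> \<omega> \<gamma> N" for \<gamma> N
    using E_minimizer_le_F_minimizer[OF that(2) tilde that(1)] .
  have star: "E_minimizer \<delta> \<omega> \<gamma> (N_star \<delta> \<omega> \<gamma>)" if "\<gamma> > 0" for \<gamma>
    unfolding N_star_def
    by (rule GreatestI_ex_nat[OF E_minimizer_exists[OF tilde that]]) (rule le_tilde[OF that])
  have greatest: "N \<le> N_star \<delta> \<omega> \<gamma>" if "\<gamma> > 0" "E_minimizer \<delta> \<omega> \<gamma> N" for \<gamma> N
    unfolding N_star_def
    by (rule Greatest_le_nat[of "E_minimizer \<delta> \<omega> \<gamma>", OF that(2)]) (rule le_tilde[OF that(1)])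
  have "mono_on {0<..} (N_star \<delta> \<omega>)"
  proof (rule mono_onI)
    fix \<gamma>1 \<gamma>2 :: real
    assume *: "\<gamma>1 \<in> {0<..}" "\<gamma>2 \<in> {0<..}" "\<gamma>1 \<le> \<gamma>2"
    show "N_star \<delta> \<omega> \<gamma>1 \<le> N_star \<delta> \<omega> \<gamma>2"
      using E_minimizer_mono[OF star star, of \<gamma>1 \<gamma>2] * by (cases "\<gamma>1 = \<gamma>2") auto
  qed
  with star greatest le_tilde tilde show ?thesis by blast
qed

end
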